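(* Let $\theta\in\mathbb R$ and $\mu,\nu,\iota,\lambda\in\mathbb P_\varepsilon$. Then $${}^*\mathbb Z^{\mu[\iota]}_\nu(\theta|x^{-1})+{}^*\mathbb Z^{\nu[\lambda]}_\mu(\theta|x^{-1})\subset{}^*\mathbb Z^{\mu-\nu[\iota+\lambda]}(\theta|x^{-1}).$$ In particular, ${}^*\mathbb Z^{\mu}_\nu(\theta|x^{-1})+{}^*\mathbb Z^{\nu}_\mu(\theta|x^{-1})\subset{}^*\mathbb Z^{\mu-\nu}(\theta|x^{-1})$.
   Context: Fix a nonprincipal ultrafilter $\mathfrak u$ on $\mathbb N$, and let ${}^*\mathbb Z\subset{}^*\mathbb R$ be the ultrapowers of $\mathbb Z\subset\mathbb R$. Let ${}^*\mathbb R_{\rm fin}$ be the ring of bounded elements, ${}^*\mathbb R_\varepsilon$ its ideal of infinitesimals, and $({}^*\mathbb R_{\rm fin})^\times_+$ the multiplicative group of positive elements that are neither infinite nor infinitesimal. Let $\mathbb P:=({}^*\mathbb R_{>0}\cup\{0\})/({}^*\mathbb R_{\rm fin})^\times_+$; write $\langle x\rangle\in\mathbb P$ for the class of $|x|$, and $-\infty:=\langle0\rangle$. $\mathbb P$ has the induced product and total order ($\mu<\mu'$ iff $x<x'$ for all representatives; $-\infty$ is the minimum). Put $\mu+\nu:=\max(\mu,\nu)$, $\mu-\nu:=\min(\mu,\nu)$ and $|n|\cdot\mu:=\langle n\rangle\cdot\mu$ for $n\in{}^*\mathbb Z$. $\mathbb P_\varepsilon\subset\mathbb P$ is the set of classes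 of positive infinitesimals. For $\mu,\iota\in\mathbb P_\varepsilon$: ${}^*\mathbb Z^\mu:=\{n\in{}^*\mathbb Z: n=0\text{ or }\langle n\rangle^{-1}>\mu\}$ and ${}^*\mathbb Z^{\mu[\iota]}:=\{n\in{}^*\mathbb Z:|n|\cdot\mu<\iota\}$. In ${}^*\mathbb Z^{\mu-\nu[\iota+\lambda]}$ the growth index is $\mu-\nu$ and the bracketed index is $\iota+\lambda$. For $\theta\in\mathbb R$, ${}^*\mathbb Z(\theta)$ is the group of $n\in{}^*\mathbb Z$ for which there is a (unique) $n^\perp\in{}^*\mathbb Z$ with $\varepsilon(n):=n\theta-n^\perp\in{}^*\mathbb R_\varepsilon$. For $\nu\in\mathbb P_\varepsilon$, ${}^*\mathbb Z_\nu(\theta):=\{n\in{}^*\mathbb Z(\theta):\langle\varepsilon(n)\rangle\le\nu\}$. Let $${}^*\mathbb Z(\theta|x^{-1}):=\{0\ne n\in{}^*\mathbb Z(\theta):\ \exists\,C\in\mathbb R_{>0}\text{ with }|\varepsilon(n)|<C|n|^{-1}\}\cup\{0\}.$$ Put ${}^*\mathbb Z^{\mu}(\theta|x^{-1})={}^*\mathbb Z^\mu\cap{}^*\mathbb Z(\theta|x^{-1})$, ${}^*\mathbb Z^{\mu[\iota]}(\theta|x^{-1})={}^*\mathbb Z^{\mu[\iota]}\cap{}^*\mathbb Z(\theta|x^{-1})$, ${}^*\mathbb Z^{\mu}_\nu(\theta|x^{-1})={}^*\mathbb Z^\mu\cap{}^*\mathbb Z_\nu(\theta)\cap{}^*\mathbb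 Z(\theta|x^{-1})$ and ${}^*\mathbb Z^{\mu[\iota]}_\nu(\theta|x^{-1})={}^*\mathbb Z^{\mu[\iota]}\cap{}^*\mathbb Z_\nu(\theta)\cap{}^*\mathbb Z(\theta|x^{-1})$. *)

theory Defs
  imports Complex_Main
begin

definition nonprincipal_ultrafilter :: "nat filter \<Rightarrow> bool" where
  "nonprincipal_ultrafilter U \<longleftrightarrow>
     U \<noteq> bot \<and>
     (\<forall>P. eventually P U \<or> eventually (\<lambda>i. \<not> P i) U) \<and>
     (\<nexists>A. U = principal A)"


definition ultra_rel :: "nat filter \<Rightarrow> ((nat \<Rightarrow> 'a) \<times> (nat \<Rightarrow> 'a)) set" where
  "ultra_rel U = {(f, g). eventually (\<lambda>i. f i = g i) U}"

definition ultrapower :: "nat filter \<Rightarrow> (nat \<Rightarrow> 'a) set set" where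
  "ultrapower U = UNIV // ultra_rel U"

definition ultra_map ::
  "nat filter \<Rightarrow> ('a \<Rightarrow> 'b) \<Rightarrow> (nat \<Rightarrow> 'a) set \<Rightarrow> (nat \<Rightarrow> 'b) set" where
  "ultra_map U F x = (\<Union>f\<in>x. ultra_rel U `` {\<lambda>i. F (f i)})"

definition ultra_map2 ::
  "nat filter \<Rightarrow> ('a \<Rightarrow> 'b \<Rightarrow> 'c) \<Rightarrow> (nat \<Rightarrow> 'a) set \<Rightarrow> (nat \<Rightarrow> 'b) set \<Rightarrow> (nat \<Rightarrow> 'c) set" where
  "ultra_map2 U F x y = (\<Union>f\<in>x. \<Union>g\<in>y. ultra_rel U `` {\<lambda>i. F (f i) (g i)})"


type_synonym hreal = "(nat \<Rightarrow> real) set"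

definition HReal :: "nat filter \<Rightarrow> hreal set" where
  "HReal U = ultrapower U"

text \<open>The ultrapower of the integers, viewed inside the ultrapower of the reals.\<close>

definition HInt :: "nat filter \<Rightarrow> hreal set" where
  "HInt U = ultra_map U real_of_int ` ultrapower U"

definition hreal_of :: "nat filter \<Rightarrow> real \<Rightarrow> hreal" where
  "hreal_of U r = ultra_rel U `` {\<lambda>i. r}"

definition hadd :: "nat filter \<Rightarrow> hreal \<Rightarrow> hreal \<Rightarrow> hreal" where
  "hadd U = ultra_map2 U (+)"

definition hsub :: "nat filter \<Rightarrow> hreal \<Rightarrow> hreal \<Rightarrow> hreal" where
  "hsub U = ultra_map2 U (-)"

definition hmul :: "nat filter \<Rightarrow> hreal \<Rightarrow> hreal \<Rightarrow> hreal" where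
  "hmul U = ultra_map2 U (*)"

definition hinv :: "nat filter \<Rightarrow> hreal \<Rightarrow> hreal" where
  "hinv U = ultra_map U inverse"

definition habs :: "nat filter \<Rightarrow> hreal \<Rightarrow> hreal" where
  "habs U = ultra_map U abs"

definition hless :: "nat filter \<Rightarrow> hreal \<Rightarrow> hreal \<Rightarrow> bool" where
  "hless U x y \<longleftrightarrow> (\<exists>f\<in>x. \<exists>g\<in>y. eventually (\<lambda>i. f i < g i) U)"

definition hset_add :: "nat filter \<Rightarrow> hreal set \<Rightarrow> hreal set \<Rightarrow> hreal set" where
  "hset_add U A B = {hadd U x y | x y. x \<in> A \<and> y \<in> B}"

definition HFin :: "nat filter \<Rightarrow> hreal set" where
  "HFin U = {x \<in> HReal U. \<exists>C::real. hless U (habs U x) (hreal_of U C)}"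

definition HInfinitesimal :: "nat filter \<Rightarrow> hreal set" where
  "HInfinitesimal U =
     {x \<in> HReal U. \<forall>C::real. C > 0 \<longrightarrow> hless U (habs U x) (hreal_of U C)}"

definition HFin_units_pos :: "nat filter \<Rightarrow> hreal set" where
  "HFin_units_pos U = {x \<in> HFin U. x \<notin> HInfinitesimal U \<and> hless U (hreal_of U 0) x}"


type_synonym growth = "hreal set"

text \<open>\<open>Growth U\<close> is $\mathbb{P}$, \<open>growth_of U x\<close> is $\langle x\rangle$, and \<open>Growth_eps U\<close> is
  $\mathbb{P}_\varepsilon$.\<close>

definition HNonneg :: "nat filter \<Rightarrow> hreal set" where
  "HNonneg U = {x \<in> HReal U. hless U (hreal_of U 0) x} \<union> {hreal_of U 0}"

definition growth_rel :: "nat filter \<Rightarrow> (hreal \<times> hreal) set" where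
  "growth_rel U = {(x, y). x \<in> HNonneg U \<and> y \<in> HNonneg U \<and>
                           (\<exists>u\<in>HFin_units_pos U. y = hmul U u x)}"

definition Growth :: "nat filter \<Rightarrow> growth set" where
  "Growth U = HNonneg U // growth_rel U"

definition growth_of :: "nat filter \<Rightarrow> hreal \<Rightarrow> growth" where
  "growth_of U x = growth_rel U `` {habs U x}"

definition growth_mul :: "nat filter \<Rightarrow> growth \<Rightarrow> growth \<Rightarrow> growth" where
  "growth_mul U \<mu> \<nu> = (\<Union>x\<in>\<mu>. \<Union>y\<in>\<nu>. growth_rel U `` {hmul U x y})"

text \<open>Inversion is only meaningful away from the class of \<open>0\<close>.\<close>

definition growth_inv :: "nat filter \<Rightarrow> growth \<Rightarrow> growth" where
  "growth_inv U \<mu> = (\<Union>x\<in>\<mu>. growth_rel U `` {hinv U x})"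

definition growth_less :: "nat filter \<Rightarrow> growth \<Rightarrow> growth \<Rightarrow> bool" where
  "growth_less U \<mu> \<nu> \<longleftrightarrow> (\<forall>x\<in>\<mu>. \<forall>y\<in>\<nu>. hless U x y)"

definition growth_le :: "nat filter \<Rightarrow> growth \<Rightarrow> growth \<Rightarrow> bool" where
  "growth_le U \<mu> \<nu> \<longleftrightarrow> growth_less U \<mu> \<nu> \<or> \<mu> = \<nu>"

text \<open>\<open>growth_max\<close> and \<open>growth_min\<close> are the operations $\mu+\nu$ and $\mu-\nu$.\<close>

definition growth_max :: "nat filter \<Rightarrow> growth \<Rightarrow> growth \<Rightarrow> growth" where
  "growth_max U \<mu> \<nu> = (if growth_le U \<mu> \<nu> then \<nu> else \<mu>)"

definition growth_min :: "nat filter \<Rightarrow> growth \<Rightarrow> growth \<Rightarrow> growth" where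
  "growth_min U \<mu> \<nu> = (if growth_le U \<mu> \<nu> then \<mu> else \<nu>)"

text \<open>$|n|\cdot\mu$\<close>

definition growth_dilate :: "nat filter \<Rightarrow> hreal \<Rightarrow> growth \<Rightarrow> growth" where
  "growth_dilate U n \<mu> = growth_mul U (growth_of U n) \<mu>"

definition Growth_eps :: "nat filter \<Rightarrow> growth set" where
  "Growth_eps U =
     {\<mu> \<in> Growth U. \<exists>x\<in>HInfinitesimal U. hless U (hreal_of U 0) x \<and> \<mu> = growth_of U x}"


text \<open>\<open>HInt_growth U \<mu>\<close> is ${}^*\mathbb{Z}^{\mu}$ and
  \<open>HInt_fine_growth U \<mu> \<iota>\<close> is ${}^*\mathbb{Z}^{\mu[\iota]}$.\<close>

definition HInt_growth :: "nat filter \<Rightarrow> growth \<Rightarrow> hreal set" where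
  "HInt_growth U \<mu> =
     {n \<in> HInt U. n = hreal_of U 0 \<or> growth_less U \<mu> (growth_inv U (growth_of U n))}"

definition HInt_fine_growth :: "nat filter \<Rightarrow> growth \<Rightarrow> growth \<Rightarrow> hreal set" where
  "HInt_fine_growth U \<mu> \<iota> = {n \<in> HInt U. growth_less U (growth_dilate U n \<mu>) \<iota>}"

text \<open>\<open>HDioph U \<theta>\<close> is ${}^*\mathbb{Z}(\theta)$, \<open>hperp U \<theta> n\<close> is $n^\perp$ and
  \<open>herr U \<theta> n\<close> is $\varepsilon(n)$; the latter two are meaningful only for
  \<open>n \<in> HDioph U \<theta>\<close>.\<close>

definition HDioph :: "nat filter \<Rightarrow> real \<Rightarrow> hreal set" where
  "HDioph U \<theta> =
     {n \<in> HInt U. \<exists>m\<in>HInt U. hsub U (hmul U n (hreal_of U \<theta>)) m \<in> HInfinitesimal U}"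

definition hperp :: "nat filter \<Rightarrow> real \<Rightarrow> hreal \<Rightarrow> hreal" where
  "hperp U \<theta> n =
     (THE m. m \<in> HInt U \<and> hsub U (hmul U n (hreal_of U \<theta>)) m \<in> HInfinitesimal U)"

definition herr :: "nat filter \<Rightarrow> real \<Rightarrow> hreal \<Rightarrow> hreal" where
  "herr U \<theta> n = hsub U (hmul U n (hreal_of U \<theta>)) (hperp U \<theta> n)"

definition HDioph_decay :: "nat filter \<Rightarrow> growth \<Rightarrow> real \<Rightarrow> hreal set" where
  "HDioph_decay U \<nu> \<theta> = {n \<in> HDioph U \<theta>. growth_le U (growth_of U (herr U \<theta> n)) \<nu>}"

text \<open>${}^*\mathbb{Z}(\theta|x^{-1})$\<close>

definition HDioph_inv :: "nat filter \<Rightarrow> real \<Rightarrow> hreal set" where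
  "HDioph_inv U \<theta> =
     {n \<in> HDioph U \<theta>. n \<noteq> hreal_of U 0 \<and>
        (\<exists>C::real. C > 0 \<and>
           hless U (habs U (herr U \<theta> n)) (hmul U (hreal_of U C) (hinv U (habs U n))))}
     \<union> {hreal_of U 0}"

text \<open>In order: ${}^*\mathbb{Z}^{\mu}(\theta|x^{-1})$, ${}^*\mathbb{Z}^{\mu[\iota]}(\theta|x^{-1})$,
  ${}^*\mathbb{Z}^{\mu}_{\nu}(\theta|x^{-1})$, ${}^*\mathbb{Z}^{\mu[\iota]}_{\nu}(\theta|x^{-1})$.\<close>

definition HDioph_inv_growth :: "nat filter \<Rightarrow> growth \<Rightarrow> real \<Rightarrow> hreal set" where
  "HDioph_inv_growth U \<mu> \<theta> = HInt_growth U \<mu> \<inter> HDioph_inv U \<theta>"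

definition HDioph_inv_fine_growth :: "nat filter \<Rightarrow> growth \<Rightarrow> growth \<Rightarrow> real \<Rightarrow> hreal set" where
  "HDioph_inv_fine_growth U \<mu> \<iota> \<theta> = HInt_fine_growth U \<mu> \<iota> \<inter> HDioph_inv U \<theta>"

definition HDioph_inv_growth_decay :: "nat filter \<Rightarrow> growth \<Rightarrow> growth \<Rightarrow> real \<Rightarrow> hreal set" where
  "HDioph_inv_growth_decay U \<mu> \<nu> \<theta> =
     HInt_growth U \<mu> \<inter> HDioph_decay U \<nu> \<theta> \<inter> HDioph_inv U \<theta>"

definition HDioph_inv_fine_growth_decay ::
  "nat filter \<Rightarrow> growth \<Rightarrow> growth \<Rightarrow> growth \<Rightarrow> real \<Rightarrow> hreal set" where
  "HDioph_inv_fine_growth_decay U \<mu> \<iota> \<nu> \<theta> =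
     HInt_fine_growth U \<mu> \<iota> \<inter> HDioph_decay U \<nu> \<theta> \<inter> HDioph_inv U \<theta>"

end

theory Submission
  imports Defs
begin

text \<open>Choose representatives \<open>f, g\<close> of the two summands, \<open>a, b, c, d\<close> of the growth classes, and
  write \<open>e, e'\<close> for the errors. The product of error and argument for the sum is at most
  \<open>|e f| + |e' g| + |e g| + |e' f|\<close>. The diagonal terms are bounded by hypothesis, and the cross terms
  are infinitesimal since \<open>|e g| = O(b |g|)\<close> and \<open>|e' f| = O(a |f|)\<close>: the decay index of each
  summand is the growth index of the other. The growth condition follows from
  \<open>|f + g| min a b \<le> |f| a + |g| b\<close>.\<close>

section \<open>Classes of sequences and pointwise operations on them\<close>

definition ultra_class :: "nat filter \<Rightarrow> (nat \<Rightarrow> 'a) \<Rightarrow> (nat \<Rightarrow> 'a) set" where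
  "ultra_class U f = ultra_rel U `` {f}"

lemma mem_ultra_class: "g \<in> ultra_class U f \<longleftrightarrow> eventually (\<lambda>i. f i = g i) U"
  by (simp add: ultra_class_def ultra_rel_def)

lemma ultra_class_eq_iff:
  "ultra_class U f = ultra_class U g \<longleftrightarrow> eventually (\<lambda>i. f i = g i) U"
proof
  assume "ultra_class U f = ultra_class U g"
  moreover have "g \<in> ultra_class U g" by (simp add: mem_ultra_class)
  ultimately have "g \<in> ultra_class U f" by simp
  then show "eventually (\<lambda>i. f i = g i) U" by (simp add: mem_ultra_class)
next
  assume e: "eventually (\<lambda>i. f i = g i) U"
  show "ultra_class U f = ultra_class U g"
  proof (intro set_eqI iffI)
    fix h assume "h \<in> ultra_class U f"
    then have "eventually (\<lambda>i. f i = h i) U" by (simp add: mem_ultra_class)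
    with e have "eventually (\<lambda>i. g i = h i) U" by eventually_elim simp
    then show "h \<in> ultra_class U g" by (simp add: mem_ultra_class)
  next
    fix h assume "h \<in> ultra_class U g"
    then have "eventually (\<lambda>i. g i = h i) U" by (simp add: mem_ultra_class)
    with e have "eventually (\<lambda>i. f i = h i) U" by eventually_elim simp
    then show "h \<in> ultra_class U f" by (simp add: mem_ultra_class)
  qed
qed

text \<open>The union in \<open>ultra_map\<close> runs over all representatives. Sequences that
  agree almost everywhere have images that agree almost everywhere, so all members of the union
  coincide; \<open>f\<close> itself shows that there is one.\<close>

lemma ultra_map_class: "ultra_map U F (ultra_class U f) = ultra_class U (\<lambda>i. F (f i))"
proof -
  have "ultra_class U (\<lambda>i. F (h i)) = ultra_class U (\<lambda>i. F (f i))"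
    if "h \<in> ultra_class U f" for h
    using that unfolding ultra_class_eq_iff mem_ultra_class by eventually_elim simp
  moreover have "f \<in> ultra_class U f" by (simp add: mem_ultra_class)
  ultimately show ?thesis
    unfolding ultra_map_def ultra_class_def[symmetric] by blast
qed

lemma ultra_map2_class:
  "ultra_map2 U F (ultra_class U f) (ultra_class U g) = ultra_class U (\<lambda>i. F (f i) (g i))"
proof -
  have "ultra_class U (\<lambda>i. F (h i) (k i)) = ultra_class U (\<lambda>i. F (f i) (g i))"
    if "h \<in> ultra_class U f" "k \<in> ultra_class U g" for h k
    using that unfolding ultra_class_eq_iff mem_ultra_class by eventually_elim simp
  moreover have "f \<in> ultra_class U f" "g \<in> ultra_class U g" by (simp_all add: mem_ultra_class)
  ultimately show ?thesis
    unfolding ultra_map2_def ultra_class_def[symmetric] by blast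
qed

lemma hyper_class:
  "hadd U (ultra_class U f) (ultra_class U g) = ultra_class U (\<lambda>i. f i + g i)"
  "hsub U (ultra_class U f) (ultra_class U g) = ultra_class U (\<lambda>i. f i - g i)"
  "hmul U (ultra_class U f) (ultra_class U g) = ultra_class U (\<lambda>i. f i * g i)"
  "hinv U (ultra_class U f) = ultra_class U (\<lambda>i. inverse (f i))"
  "habs U (ultra_class U f) = ultra_class U (\<lambda>i. \<bar>f i\<bar>)"
  unfolding hadd_def hsub_def hmul_def hinv_def habs_def by (rule ultra_map2_class ultra_map_class)+

lemma hreal_of_class: "hreal_of U r = ultra_class U (\<lambda>i. r)"
  by (simp add: hreal_of_def ultra_class_def)

text \<open>\<open>hless\<close> asks for one good pair of representatives. A change of
  representatives costs two further almost-everywhere conditions, which can be intersected, so any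
  one pair decides.\<close>

lemma hless_class:
  "hless U (ultra_class U f) (ultra_class U g) \<longleftrightarrow> eventually (\<lambda>i. f i < g i) U"
proof
  assume "hless U (ultra_class U f) (ultra_class U g)"
  then obtain h k where "eventually (\<lambda>i. f i = h i) U" "eventually (\<lambda>i. g i = k i) U"
    "eventually (\<lambda>i. h i < k i) U"
    unfolding hless_def by (auto simp: mem_ultra_class)
  then show "eventually (\<lambda>i. f i < g i) U" by eventually_elim simp
next
  assume "eventually (\<lambda>i. f i < g i) U"
  then show "hless U (ultra_class U f) (ultra_class U g)"
    unfolding hless_def by (intro bexI[of _ f] bexI[of _ g]) (simp_all add: mem_ultra_class)
qed

lemma ultrapower_eq: "ultrapower U = range (ultra_class U)"
  unfolding ultrapower_def quotient_def ultra_class_def by auto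

lemma class_in_HReal: "ultra_class U f \<in> HReal U"
  by (simp add: HReal_def ultrapower_eq)

lemma HReal_cases:
  assumes "x \<in> HReal U" obtains f where "x = ultra_class U f"
  using assms by (auto simp: HReal_def ultrapower_eq)

section \<open>Integers, infinitesimals and approximation errors\<close>

lemma HInt_eq: "HInt U = {ultra_class U (\<lambda>i. real_of_int (k i)) | k. True}"
  unfolding HInt_def ultrapower_eq by (auto simp: ultra_map_class image_iff)

lemma HInfinitesimal_class:
  "ultra_class U f \<in> HInfinitesimal U \<longleftrightarrow> (\<forall>C>0. eventually (\<lambda>i. \<bar>f i\<bar> < C) U)"
  by (simp add: HInfinitesimal_def class_in_HReal hyper_class hreal_of_class hless_class)

lemma HInfinitesimal_add:
  assumes "ultra_class U f \<in> HInfinitesimal U" "ultra_class U g \<in> HInfinitesimal U"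
  shows "ultra_class U (\<lambda>i. f i + g i) \<in> HInfinitesimal U"
  unfolding HInfinitesimal_class
proof (intro allI impI)
  fix C :: real assume "C > 0"
  then have "eventually (\<lambda>i. \<bar>f i\<bar> < C / 2) U" "eventually (\<lambda>i. \<bar>g i\<bar> < C / 2) U"
    using assms unfolding HInfinitesimal_class by (meson half_gt_zero)+
  then show "eventually (\<lambda>i. \<bar>f i + g i\<bar> < C) U" by eventually_elim linarith
qed

text \<open>Evaluates the definite description in \<open>hperp\<close>: integer sequences with
  infinitesimal error agree almost everywhere, so the error may be computed with whichever
  \<open>p\<close> is at hand.\<close>

lemma herr_class:
  assumes inf: "ultra_class U (\<lambda>i. f i * \<theta> - real_of_int (p i)) \<in> HInfinitesimal U"
  shows "herr U \<theta> (ultra_class U f) = ultra_class U (\<lambda>i. f i * \<theta> - real_of_int (p i))"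
proof -
  have "hperp U \<theta> (ultra_class U f) = ultra_class U (\<lambda>i. real_of_int (p i))"
    unfolding hperp_def
  proof (rule the_equality)
    show "ultra_class U (\<lambda>i. real_of_int (p i)) \<in> HInt U \<and>
      hsub U (hmul U (ultra_class U f) (hreal_of U \<theta>)) (ultra_class U (\<lambda>i. real_of_int (p i)))
        \<in> HInfinitesimal U"
      using inf by (auto simp: HInt_eq hyper_class hreal_of_class)
  next
    fix m assume m: "m \<in> HInt U \<and> hsub U (hmul U (ultra_class U f) (hreal_of U \<theta>)) m \<in> HInfinitesimal U"
    then obtain q where q: "m = ultra_class U (\<lambda>i. real_of_int (q i))"
      by (auto simp: HInt_eq)
    \<comment> \<open>Tolerance 1/2 is enough: two integers that lie within 1/2 of the same real
      differ by less than 1.\<close>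
    have "eventually (\<lambda>i. \<bar>f i * \<theta> - real_of_int (q i)\<bar> < 1/2) U"
      using m[unfolded q]
      unfolding hyper_class hreal_of_class HInfinitesimal_class by (meson half_gt_zero zero_less_one)
    moreover have "eventually (\<lambda>i. \<bar>f i * \<theta> - real_of_int (p i)\<bar> < 1/2) U"
      using inf unfolding HInfinitesimal_class by (meson half_gt_zero zero_less_one)
    ultimately have "eventually (\<lambda>i. real_of_int (q i) = real_of_int (p i)) U"
    proof eventually_elim
      case (elim i)
      then have "\<bar>real_of_int (q i - p i)\<bar> < 1" unfolding of_int_diff by linarith
      then have "\<bar>q i - p i\<bar> < 1" by linarith
      then show ?case by simp
    qed
    then show "m = ultra_class U (\<lambda>i. real_of_int (p i))"
      by (simp add: q ultra_class_eq_iff)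
  qed
  then show ?thesis by (simp add: herr_def hyper_class hreal_of_class)
qed

lemma HDioph_class:
  assumes "ultra_class U f \<in> HDioph U \<theta>"
  obtains p :: "nat \<Rightarrow> int" where
    "ultra_class U (\<lambda>i. f i * \<theta> - real_of_int (p i)) \<in> HInfinitesimal U"
  using assms by (auto simp: HDioph_def HInt_eq hyper_class hreal_of_class)

section \<open>Ultrafilter dichotomy; growth classes as comparability classes of sequences\<close>

locale ultra =
  fixes U :: "nat filter"
  assumes not_bot: "U \<noteq> bot"
    and ultra: "eventually P U \<or> eventually (\<lambda>i. \<not> P i) U"
begin

abbreviation cls :: "(nat \<Rightarrow> real) \<Rightarrow> hreal" where "cls \<equiv> ultra_class U"

text \<open>Properness forbids a property and its negation from both holding almost everywhere;
  maximality supplies one of them. Failure of an estimate thus becomes the reverse estimate almost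
  everywhere, which is how growth classes are compared below.\<close>

lemma not_eventually_iff: "\<not> eventually P U \<longleftrightarrow> eventually (\<lambda>i. \<not> P i) U"
proof
  assume e: "eventually (\<lambda>i. \<not> P i) U"
  show "\<not> eventually P U"
  proof
    assume "eventually P U"
    with e have "eventually (\<lambda>i. False) U" by eventually_elim simp
    with not_bot show False by (simp add: eventually_False)
  qed
qed (use ultra in blast)

lemma HNonneg_class: "cls f \<in> HNonneg U \<longleftrightarrow> eventually (\<lambda>i. 0 \<le> f i) U"
proof
  assume "cls f \<in> HNonneg U"
  then have "eventually (\<lambda>i. 0 < f i) U \<or> eventually (\<lambda>i. f i = 0) U"
    by (auto simp: HNonneg_def hreal_of_class hless_class ultra_class_eq_iff)
  then show "eventually (\<lambda>i. 0 \<le> f i) U" by (auto elim: eventually_mono)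
next
  assume e: "eventually (\<lambda>i. 0 \<le> f i) U"
  \<comment> \<open>\<open>HNonneg\<close> treats positive elements and zero apart; a nonnegative
    \<open>f\<close> that is not almost everywhere positive is zero almost everywhere by the
    dichotomy.\<close>
  have "eventually (\<lambda>i. f i = 0) U" if "\<not> eventually (\<lambda>i. 0 < f i) U"
    using that e unfolding not_eventually_iff by eventually_elim simp
  then show "cls f \<in> HNonneg U"
    by (auto simp: HNonneg_def hreal_of_class hless_class ultra_class_eq_iff class_in_HReal)
qed

text \<open>One constant records everything: \<open>u <= C\<close> is finiteness, and
  \<open>1 <= C * u\<close> keeps \<open>u\<close> above \<open>1/C\<close>, hence positive and not
  infinitesimal.\<close>

lemma HFin_units_pos_class:
  "cls u \<in> HFin_units_pos U \<longleftrightarrow> (\<exists>C>0. eventually (\<lambda>i. 1 \<le> C * u i \<and> u i \<le> C) U)"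
proof
  assume "cls u \<in> HFin_units_pos U"
  then obtain C D where C: "eventually (\<lambda>i. \<bar>u i\<bar> < C) U" and "D > 0"
    and D: "\<not> eventually (\<lambda>i. \<bar>u i\<bar> < D) U" and pos: "eventually (\<lambda>i. 0 < u i) U"
    by (auto simp: HFin_units_pos_def HFin_def HInfinitesimal_class hyper_class hreal_of_class
        hless_class)
  \<comment> \<open>\<open>C\<close> bounds \<open>u\<close> from above. Failure of
    \<open>\<bar>u i\<bar> < D\<close> puts \<open>u\<close> above \<open>D\<close> almost
    everywhere, so \<open>1/D\<close> serves for the lower bound.\<close>
  have "eventually (\<lambda>i. 1 \<le> max C (1/D) * u i \<and> u i \<le> max C (1/D)) U"
    using C D[unfolded not_eventually_iff] pos
  proof eventually_elim
    case (elim i)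
    then have "1 \<le> 1/D * u i" using \<open>D > 0\<close> by (simp add: field_simps)
    also have "\<dots> \<le> max C (1/D) * u i" using elim by (intro mult_right_mono) auto
    finally show ?case using elim by auto
  qed
  moreover have "max C (1/D) > 0" using \<open>D > 0\<close> by (simp add: less_max_iff_disj)
  ultimately show "\<exists>C>0. eventually (\<lambda>i. 1 \<le> C * u i \<and> u i \<le> C) U" by blast
next
  assume "\<exists>C>0. eventually (\<lambda>i. 1 \<le> C * u i \<and> u i \<le> C) U"
  then obtain C where "C > 0" and C: "eventually (\<lambda>i. 1 \<le> C * u i \<and> u i \<le> C) U" by blast
  have pos: "eventually (\<lambda>i. 0 < u i) U"
    using C by eventually_elim (metis \<open>C > 0\<close> less_le_trans zero_less_mult_pos zero_less_one)
  have "eventually (\<lambda>i. \<bar>u i\<bar> < C + 1) U"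
    using C pos by eventually_elim simp
  moreover have "\<not> eventually (\<lambda>i. \<bar>u i\<bar> < 1/C) U"
    unfolding not_eventually_iff using C pos
    by eventually_elim (use \<open>C > 0\<close> in \<open>simp add: field_simps\<close>)
  moreover have "1/C > 0" using \<open>C > 0\<close> by simp
  ultimately show "cls u \<in> HFin_units_pos U"
    using pos unfolding HFin_units_pos_def HFin_def mem_Collect_eq HInfinitesimal_class
      hyper_class hreal_of_class hless_class by (blast intro: class_in_HReal)
qed

text \<open>This is \<open>growth_rel\<close> read on representatives: each sequence is big-O of the
  other. The absolute values admit signed sequences, in keeping with \<open>growth_of\<close>, which
  applies \<open>habs\<close> first.\<close>

definition comparable :: "(nat \<Rightarrow> real) \<Rightarrow> (nat \<Rightarrow> real) \<Rightarrow> bool" where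
  "comparable f g \<longleftrightarrow> (\<exists>C>0. eventually (\<lambda>i. \<bar>f i\<bar> \<le> C * \<bar>g i\<bar> \<and> \<bar>g i\<bar> \<le> C * \<bar>f i\<bar>) U)"

lemma comparable_refl: "comparable f f"
  unfolding comparable_def by (intro exI[of _ 1]) simp

lemma comparable_sym: "comparable f g \<Longrightarrow> comparable g f"
  unfolding comparable_def by (auto simp: conj_commute)

text \<open>The two constants may differ and have any sign; both can be enlarged to a common
  \<open>E >= 1\<close> because they multiply absolute values.\<close>

lemma comparableI:
  assumes "eventually (\<lambda>i. \<bar>f i\<bar> \<le> C * \<bar>g i\<bar>) U" "eventually (\<lambda>i. \<bar>g i\<bar> \<le> D * \<bar>f i\<bar>) U"
  shows "comparable f g"
proof -
  define E where "E = max 1 (max C D)"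
  have "eventually (\<lambda>i. \<bar>f i\<bar> \<le> E * \<bar>g i\<bar> \<and> \<bar>g i\<bar> \<le> E * \<bar>f i\<bar>) U"
    using assms
  proof eventually_elim
    case (elim i)
    have "C * \<bar>g i\<bar> \<le> E * \<bar>g i\<bar>" "D * \<bar>f i\<bar> \<le> E * \<bar>f i\<bar>"
      by (intro mult_right_mono; simp add: E_def)+
    with elim show ?case by linarith
  qed
  moreover have "E > 0" by (simp add: E_def)
  ultimately show ?thesis unfolding comparable_def by blast
qed

lemma comparable_mult:
  assumes "comparable f g" "comparable h k"
  shows "comparable (\<lambda>i. f i * h i) (\<lambda>i. g i * k i)"
proof -
  obtain C D where "C > 0" "D > 0"
    and C: "eventually (\<lambda>i. \<bar>f i\<bar> \<le> C * \<bar>g i\<bar> \<and> \<bar>g i\<bar> \<le> C * \<bar>f i\<bar>) U"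
    and D: "eventually (\<lambda>i. \<bar>h i\<bar> \<le> D * \<bar>k i\<bar> \<and> \<bar>k i\<bar> \<le> D * \<bar>h i\<bar>) U"
    using assms unfolding comparable_def by blast
  show ?thesis
  proof (rule comparableI)
    show "eventually (\<lambda>i. \<bar>f i * h i\<bar> \<le> (C * D) * \<bar>g i * k i\<bar>) U"
      using C D
    proof eventually_elim
      case (elim i)
      then have "\<bar>f i\<bar> * \<bar>h i\<bar> \<le> (C * \<bar>g i\<bar>) * (D * \<bar>k i\<bar>)"
        using \<open>C > 0\<close> by (intro mult_mono) auto
      then show ?case by (simp add: abs_mult ac_simps)
    qed
    show "eventually (\<lambda>i. \<bar>g i * k i\<bar> \<le> (C * D) * \<bar>f i * h i\<bar>) U"
      using C D
    proof eventually_elim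
      case (elim i)
      then have "\<bar>g i\<bar> * \<bar>k i\<bar> \<le> (C * \<bar>f i\<bar>) * (D * \<bar>h i\<bar>)"
        using \<open>C > 0\<close> by (intro mult_mono) auto
      then show ?case by (simp add: abs_mult ac_simps)
    qed
  qed
qed

lemma comparable_trans:
  assumes "comparable f g" "comparable g h"
  shows "comparable f h"
proof -
  obtain C D where "C > 0" "D > 0"
    and C: "eventually (\<lambda>i. \<bar>f i\<bar> \<le> C * \<bar>g i\<bar> \<and> \<bar>g i\<bar> \<le> C * \<bar>f i\<bar>) U"
    and D: "eventually (\<lambda>i. \<bar>g i\<bar> \<le> D * \<bar>h i\<bar> \<and> \<bar>h i\<bar> \<le> D * \<bar>g i\<bar>) U"
    using assms unfolding comparable_def by blast
  show ?thesis
  proof (rule comparableI)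
    show "eventually (\<lambda>i. \<bar>f i\<bar> \<le> (C * D) * \<bar>h i\<bar>) U"
      using C D
    proof eventually_elim
      case (elim i)
      then have "C * \<bar>g i\<bar> \<le> C * (D * \<bar>h i\<bar>)" using \<open>C > 0\<close> by simp
      with elim show ?case by (simp add: ac_simps)
    qed
    show "eventually (\<lambda>i. \<bar>h i\<bar> \<le> (C * D) * \<bar>f i\<bar>) U"
      using C D
    proof eventually_elim
      case (elim i)
      then have "D * \<bar>g i\<bar> \<le> D * (C * \<bar>f i\<bar>)" using \<open>D > 0\<close> by simp
      with elim show ?case by (simp add: ac_simps)
    qed
  qed
qed

lemma comparable_inverse:
  assumes "comparable f g"
  shows "comparable (\<lambda>i. inverse (f i)) (\<lambda>i. inverse (g i))"
proof -
  obtain C where "C > 0"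
    and C: "eventually (\<lambda>i. \<bar>f i\<bar> \<le> C * \<bar>g i\<bar> \<and> \<bar>g i\<bar> \<le> C * \<bar>f i\<bar>) U"
    using assms unfolding comparable_def by blast
  have "eventually (\<lambda>i. \<bar>inverse (f i)\<bar> \<le> C * \<bar>inverse (g i)\<bar> \<and>
          \<bar>inverse (g i)\<bar> \<le> C * \<bar>inverse (f i)\<bar>) U"
    using C
  proof eventually_elim
    case (elim i)
    show ?case
    proof (cases "f i = 0 \<or> g i = 0")
      case True
      \<comment> \<open>Comparability makes both values vanish together, and
        \<open>inverse 0 = 0\<close> then makes the estimates trivial.\<close>
      with elim have "f i = 0" "g i = 0" by auto
      then show ?thesis by simp
    next
      case False
      then show ?thesis using elim by (auto simp: field_simps)
    qed
  qed
  with \<open>C > 0\<close> show ?thesis unfolding comparable_def by blast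
qed

text \<open>The lower bound on the unit gives \<open>f = O(g)\<close> and its upper bound gives
  \<open>g = O(f)\<close>; conversely the quotient \<open>g / f\<close> is the required
  unit.\<close>

lemma growth_rel_class:
  "(cls f, cls g) \<in> growth_rel U \<longleftrightarrow>
    eventually (\<lambda>i. 0 \<le> f i) U \<and> eventually (\<lambda>i. 0 \<le> g i) U \<and> comparable f g"
proof
  assume "(cls f, cls g) \<in> growth_rel U"
  then obtain u where f: "eventually (\<lambda>i. 0 \<le> f i) U" and g: "eventually (\<lambda>i. 0 \<le> g i) U"
    and u: "u \<in> HFin_units_pos U" and gu: "cls g = hmul U u (cls f)"
    by (auto simp: growth_rel_def HNonneg_class)
  obtain v where v: "u = cls v"
    using u by (auto simp: HFin_units_pos_def HFin_def elim: HReal_cases)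
  obtain C where "C > 0" and C: "eventually (\<lambda>i. 1 \<le> C * v i \<and> v i \<le> C) U"
    using u unfolding v HFin_units_pos_class by blast
  have e: "eventually (\<lambda>i. g i = v i * f i) U"
    using gu by (simp add: v hyper_class ultra_class_eq_iff)
  have "comparable f g"
  proof (rule comparableI)
    show "eventually (\<lambda>i. \<bar>f i\<bar> \<le> C * \<bar>g i\<bar>) U"
      using C e f g
    proof eventually_elim
      case (elim i)
      then have "1 * f i \<le> (C * v i) * f i" by (intro mult_right_mono) auto
      with elim show ?case by (simp add: ac_simps)
    qed
    show "eventually (\<lambda>i. \<bar>g i\<bar> \<le> C * \<bar>f i\<bar>) U"
      using C e f g
    proof eventually_elim
      case (elim i)
      then have "v i * f i \<le> C * f i" by (intro mult_right_mono) auto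
      with elim show ?case by simp
    qed
  qed
  with f g show "eventually (\<lambda>i. 0 \<le> f i) U \<and> eventually (\<lambda>i. 0 \<le> g i) U \<and> comparable f g"
    by simp
next
  assume *: "eventually (\<lambda>i. 0 \<le> f i) U \<and> eventually (\<lambda>i. 0 \<le> g i) U \<and> comparable f g"
  then obtain C where "C > 0"
    and C: "eventually (\<lambda>i. \<bar>f i\<bar> \<le> C * \<bar>g i\<bar> \<and> \<bar>g i\<bar> \<le> C * \<bar>f i\<bar>) U"
    unfolding comparable_def by blast
  from * have f: "eventually (\<lambda>i. 0 \<le> f i) U" and g: "eventually (\<lambda>i. 0 \<le> g i) U" by simp_all
  \<comment> \<open>Where \<open>f i = 0\<close>, comparability gives \<open>g i = 0\<close>, so any
    value of \<open>v i\<close> would satisfy \<open>g i = v i * f i\<close>. The default 1 keeps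
    \<open>v\<close> a unit, and the bound \<open>max 1 C\<close> makes room for it.\<close>
  define v where "v = (\<lambda>i. if f i = 0 then 1 else g i / f i)"
  have "eventually (\<lambda>i. 1 \<le> max 1 C * v i \<and> v i \<le> max 1 C) U"
    using C f g
  proof eventually_elim
    case (elim i)
    show ?case
    proof (cases "f i = 0")
      case True
      then show ?thesis by (simp add: v_def)
    next
      case False
      with elim have fp: "f i > 0" by simp
      with elim have "1 \<le> C * v i" "v i \<le> C" "0 \<le> v i" by (auto simp: v_def field_simps)
      moreover from \<open>0 \<le> v i\<close> have "C * v i \<le> max 1 C * v i" by (intro mult_right_mono) auto
      ultimately show ?thesis by linarith
    qed
  qed
  moreover have "max 1 C > 0" by simp
  ultimately have "cls v \<in> HFin_units_pos U" unfolding HFin_units_pos_class by blast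
  moreover have "cls g = hmul U (cls v) (cls f)"
    unfolding hyper_class ultra_class_eq_iff using C by eventually_elim (auto simp: v_def)
  ultimately show "(cls f, cls g) \<in> growth_rel U"
    using f[folded HNonneg_class] g[folded HNonneg_class] unfolding growth_rel_def by blast
qed

lemma class_in_growth_of:
  "cls g \<in> growth_of U (cls f) \<longleftrightarrow> eventually (\<lambda>i. 0 \<le> g i) U \<and> comparable f g"
proof -
  have "comparable (\<lambda>i. \<bar>f i\<bar>) g \<longleftrightarrow> comparable f g" by (simp add: comparable_def)
  then show ?thesis by (simp add: growth_of_def hyper_class growth_rel_class)
qed

lemma growth_of_cases:
  assumes "x \<in> growth_of U (cls f)"
  obtains g where "x = cls g" "eventually (\<lambda>i. 0 \<le> g i) U" "comparable f g"
proof -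
  from assms have "x \<in> HNonneg U" by (auto simp: growth_of_def growth_rel_def)
  then have "x \<in> HReal U" by (auto simp: HNonneg_def hreal_of_class class_in_HReal)
  then obtain g where "x = cls g" by (rule HReal_cases)
  with assms that show ?thesis by (auto simp: class_in_growth_of)
qed

lemma abs_class_in_growth_of: "cls (\<lambda>i. \<bar>f i\<bar>) \<in> growth_of U (cls f)"
  using comparable_refl[of f] by (simp add: class_in_growth_of comparable_def)

lemma growth_of_eq_iff: "growth_of U (cls f) = growth_of U (cls g) \<longleftrightarrow> comparable f g"
proof
  assume "growth_of U (cls f) = growth_of U (cls g)"
  then have "cls (\<lambda>i. \<bar>g i\<bar>) \<in> growth_of U (cls f)" by (simp add: abs_class_in_growth_of)
  then show "comparable f g" by (simp add: class_in_growth_of comparable_def)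
next
  assume fg: "comparable f g"
  show "growth_of U (cls f) = growth_of U (cls g)"
    by (intro set_eqI iffI; erule growth_of_cases)
      (use fg in \<open>auto simp: class_in_growth_of intro: comparable_trans comparable_sym\<close>)
qed

text \<open>\<open>growth_mul\<close> and \<open>growth_inv\<close> apply \<open>growth_rel\<close>
  without absolute values; on nonnegative representatives this produces the same class as
  \<open>growth_of\<close>.\<close>

lemma growth_rel_Image:
  assumes "eventually (\<lambda>i. 0 \<le> f i) U"
  shows "growth_rel U `` {cls f} = growth_of U (cls f)"
proof -
  have "cls (\<lambda>i. \<bar>f i\<bar>) = cls f"
    unfolding ultra_class_eq_iff using assms by eventually_elim simp
  then show ?thesis by (simp add: growth_of_def hyper_class)
qed

section \<open>Operations and order on growth classes\<close>

lemma growth_mul_class: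
  "growth_mul U (growth_of U (cls f)) (growth_of U (cls g)) = growth_of U (cls (\<lambda>i. f i * g i))"
proof -
  have "growth_rel U `` {hmul U x y} = growth_of U (cls (\<lambda>i. f i * g i))"
    if x: "x \<in> growth_of U (cls f)" and y: "y \<in> growth_of U (cls g)" for x y
  proof -
    obtain h where h: "x = cls h" "eventually (\<lambda>i. 0 \<le> h i) U" "comparable f h"
      using x by (rule growth_of_cases)
    obtain k where k: "y = cls k" "eventually (\<lambda>i. 0 \<le> k i) U" "comparable g k"
      using y by (rule growth_of_cases)
    have "eventually (\<lambda>i. 0 \<le> h i * k i) U" using h(2) k(2) by eventually_elim simp
    moreover have "comparable (\<lambda>i. h i * k i) (\<lambda>i. f i * g i)"
      using h(3) k(3) by (rule comparable_mult[THEN comparable_sym])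
    ultimately show ?thesis
      by (simp add: h(1) k(1) hyper_class growth_rel_Image growth_of_eq_iff)
  qed
  then show ?thesis
    unfolding growth_mul_def using abs_class_in_growth_of by blast
qed

lemma growth_inv_class:
  "growth_inv U (growth_of U (cls f)) = growth_of U (cls (\<lambda>i. inverse (f i)))"
proof -
  have "growth_rel U `` {hinv U x} = growth_of U (cls (\<lambda>i. inverse (f i)))"
    if "x \<in> growth_of U (cls f)" for x
  proof -
    obtain h where h: "x = cls h" "eventually (\<lambda>i. 0 \<le> h i) U" "comparable f h"
      using \<open>x \<in> growth_of U (cls f)\<close> by (rule growth_of_cases)
    have "eventually (\<lambda>i. 0 \<le> inverse (h i)) U" using h(2) by eventually_elim simp
    moreover have "comparable (\<lambda>i. inverse (h i)) (\<lambda>i. inverse (f i))"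
      using h(3) by (rule comparable_inverse[THEN comparable_sym])
    ultimately show ?thesis
      by (simp add: h(1) hyper_class growth_rel_Image growth_of_eq_iff)
  qed
  then show ?thesis
    unfolding growth_inv_def using abs_class_in_growth_of by blast
qed

text \<open>A growth class is closed under scaling by positive standard reals, so lying below for
  all representatives amounts to \<open>f = o(g)\<close>.\<close>

lemma growth_less_class:
  "growth_less U (growth_of U (cls f)) (growth_of U (cls g)) \<longleftrightarrow>
    (\<forall>C>0. eventually (\<lambda>i. C * \<bar>f i\<bar> < \<bar>g i\<bar>) U)"
proof (intro iffI allI impI)
  fix C :: real
  assume less: "growth_less U (growth_of U (cls f)) (growth_of U (cls g))" and "C > 0"
  \<comment> \<open>The multiple is itself a representative of the smaller class, so the hypothesis
    applies to it directly.\<close>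
  have "comparable f (\<lambda>i. C * \<bar>f i\<bar>)"
    by (rule comparableI[of _ "1/C" _ C]) (use \<open>C > 0\<close> in \<open>auto simp: abs_mult\<close>)
  then have "cls (\<lambda>i. C * \<bar>f i\<bar>) \<in> growth_of U (cls f)"
    using \<open>C > 0\<close> by (simp add: class_in_growth_of)
  with less have "hless U (cls (\<lambda>i. C * \<bar>f i\<bar>)) (cls (\<lambda>i. \<bar>g i\<bar>))"
    using abs_class_in_growth_of unfolding growth_less_def by blast
  then show "eventually (\<lambda>i. C * \<bar>f i\<bar> < \<bar>g i\<bar>) U" by (simp add: hless_class)
next
  assume less: "\<forall>C>0. eventually (\<lambda>i. C * \<bar>f i\<bar> < \<bar>g i\<bar>) U"
  show "growth_less U (growth_of U (cls f)) (growth_of U (cls g))"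
    unfolding growth_less_def
  proof (intro ballI)
    fix x y assume x: "x \<in> growth_of U (cls f)" and y: "y \<in> growth_of U (cls g)"
    obtain h where h: "x = cls h" "eventually (\<lambda>i. 0 \<le> h i) U" "comparable f h"
      using x by (rule growth_of_cases)
    obtain k where k: "y = cls k" "eventually (\<lambda>i. 0 \<le> k i) U" "comparable g k"
      using y by (rule growth_of_cases)
    obtain C D where "C > 0" "D > 0"
      and C: "eventually (\<lambda>i. \<bar>f i\<bar> \<le> C * \<bar>h i\<bar> \<and> \<bar>h i\<bar> \<le> C * \<bar>f i\<bar>) U"
      and D: "eventually (\<lambda>i. \<bar>g i\<bar> \<le> D * \<bar>k i\<bar> \<and> \<bar>k i\<bar> \<le> D * \<bar>g i\<bar>) U"
      using h(3) k(3) unfolding comparable_def by blast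
    \<comment> \<open>\<open>C\<close> pays for the passage from \<open>f\<close> to
      \<open>h\<close> and \<open>D\<close> for that from \<open>g\<close> to \<open>k\<close>; the
      product absorbs both.\<close>
    have "eventually (\<lambda>i. (D * C) * \<bar>f i\<bar> < \<bar>g i\<bar>) U"
      using less \<open>C > 0\<close> \<open>D > 0\<close> by simp
    then have "eventually (\<lambda>i. h i < k i) U"
      using h(2) k(2) C D
    proof eventually_elim
      case (elim i)
      then have "D * (C * \<bar>f i\<bar>) < D * k i" by (simp add: ac_simps)
      then have "C * \<bar>f i\<bar> < k i" using \<open>D > 0\<close> by simp
      with elim show ?case by linarith
    qed
    then show "hless U x y" by (simp add: h(1) k(1) hless_class)
  qed
qed

text \<open>The weak order is \<open>f = O(g)\<close>. If \<open>f = O(g)\<close> holds but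
  \<open>f = o(g)\<close> fails at a constant \<open>D\<close>, the dichotomy gives
  \<open>g = O(f)\<close> with that same \<open>D\<close>, so the classes coincide.\<close>

lemma growth_le_class:
  "growth_le U (growth_of U (cls f)) (growth_of U (cls g)) \<longleftrightarrow>
    (\<exists>C>0. eventually (\<lambda>i. \<bar>f i\<bar> \<le> C * \<bar>g i\<bar>) U)"
proof
  assume "growth_le U (growth_of U (cls f)) (growth_of U (cls g))"
  then consider "\<forall>C>0. eventually (\<lambda>i. C * \<bar>f i\<bar> < \<bar>g i\<bar>) U" | "comparable f g"
    unfolding growth_le_def growth_less_class growth_of_eq_iff by blast
  then show "\<exists>C>0. eventually (\<lambda>i. \<bar>f i\<bar> \<le> C * \<bar>g i\<bar>) U"
  proof cases
    case 1
    then have "eventually (\<lambda>i. 1 * \<bar>f i\<bar> < \<bar>g i\<bar>) U" by (metis zero_less_one)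
    then have "eventually (\<lambda>i. \<bar>f i\<bar> \<le> 1 * \<bar>g i\<bar>) U" by eventually_elim simp
    then show ?thesis using zero_less_one by blast
  next
    case 2
    then show ?thesis unfolding comparable_def by (auto elim!: eventually_mono)
  qed
next
  assume "\<exists>C>0. eventually (\<lambda>i. \<bar>f i\<bar> \<le> C * \<bar>g i\<bar>) U"
  then obtain C where C: "eventually (\<lambda>i. \<bar>f i\<bar> \<le> C * \<bar>g i\<bar>) U" by blast
  have "comparable f g" if "D > 0" "\<not> eventually (\<lambda>i. D * \<bar>f i\<bar> < \<bar>g i\<bar>) U" for D
  proof (rule comparableI[OF C])
    show "eventually (\<lambda>i. \<bar>g i\<bar> \<le> D * \<bar>f i\<bar>) U"
      using that(2) unfolding not_eventually_iff by eventually_elim simp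
  qed
  then show "growth_le U (growth_of U (cls f)) (growth_of U (cls g))"
    unfolding growth_le_def growth_less_class growth_of_eq_iff by blast
qed

lemma not_growth_le_class:
  assumes "\<not> growth_le U (growth_of U (cls f)) (growth_of U (cls g))"
  shows "eventually (\<lambda>i. \<bar>g i\<bar> < \<bar>f i\<bar>) U"
proof -
  have "\<not> eventually (\<lambda>i. \<bar>f i\<bar> \<le> 1 * \<bar>g i\<bar>) U"
    using assms unfolding growth_le_class by (metis zero_less_one)
  then show ?thesis unfolding not_eventually_iff by eventually_elim simp
qed

text \<open>\<open>growth_min\<close> selects one class, whereas the pointwise minimum may alternate
  between the two sequences. If \<open>a = O(b)\<close>, it stays comparable to \<open>a\<close> all
  the same; otherwise \<open>b\<close> is smaller almost everywhere and is the minimum.\<close>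

lemma growth_min_class:
  "growth_min U (growth_of U (cls a)) (growth_of U (cls b)) =
    growth_of U (cls (\<lambda>i. min \<bar>a i\<bar> \<bar>b i\<bar>))"
proof (cases "growth_le U (growth_of U (cls a)) (growth_of U (cls b))")
  case True
  then obtain C where C: "eventually (\<lambda>i. \<bar>a i\<bar> \<le> C * \<bar>b i\<bar>) U"
    unfolding growth_le_class by blast
  have "comparable a (\<lambda>i. min \<bar>a i\<bar> \<bar>b i\<bar>)"
  proof (rule comparableI)
    \<comment> \<open>The factor 1 is for indices where the minimum is
      \<open>\<bar>a i\<bar>\<close>, the factor \<open>C\<close> for those where it is
      \<open>\<bar>b i\<bar>\<close>.\<close>
    show "eventually (\<lambda>i. \<bar>a i\<bar> \<le> max 1 C * \<bar>min \<bar>a i\<bar> \<bar>b i\<bar>\<bar>) U"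
      using C
    proof eventually_elim
      case (elim i)
      have "1 * \<bar>a i\<bar> \<le> max 1 C * \<bar>a i\<bar>" "C * \<bar>b i\<bar> \<le> max 1 C * \<bar>b i\<bar>"
        by (intro mult_right_mono; simp)+
      with elim show ?case by (auto simp: min_def)
    qed
    show "eventually (\<lambda>i. \<bar>min \<bar>a i\<bar> \<bar>b i\<bar>\<bar> \<le> 1 * \<bar>a i\<bar>) U" by simp
  qed
  with True show ?thesis by (simp add: growth_min_def growth_of_eq_iff)
next
  case False
  then have "eventually (\<lambda>i. \<bar>b i\<bar> < \<bar>a i\<bar>) U" by (rule not_growth_le_class)
  then have "eventually (\<lambda>i. \<bar>b i\<bar> = min \<bar>a i\<bar> \<bar>b i\<bar>) U" by eventually_elim simp
  then have "comparable b (\<lambda>i. min \<bar>a i\<bar> \<bar>b i\<bar>)"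
    by (intro comparableI[of _ 1 _ 1]; eventually_elim) simp_all
  with False show ?thesis by (simp add: growth_min_def growth_of_eq_iff)
qed

text \<open>Dual to the minimum: if \<open>a = O(b)\<close>, the pointwise maximum is squeezed
  between \<open>\<bar>b i\<bar>\<close> and a constant multiple of it.\<close>

lemma growth_max_class:
  "growth_max U (growth_of U (cls a)) (growth_of U (cls b)) =
    growth_of U (cls (\<lambda>i. max \<bar>a i\<bar> \<bar>b i\<bar>))"
proof (cases "growth_le U (growth_of U (cls a)) (growth_of U (cls b))")
  case True
  then obtain C where C: "eventually (\<lambda>i. \<bar>a i\<bar> \<le> C * \<bar>b i\<bar>) U"
    unfolding growth_le_class by blast
  have "comparable b (\<lambda>i. max \<bar>a i\<bar> \<bar>b i\<bar>)"
  proof (rule comparableI)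
    show "eventually (\<lambda>i. \<bar>b i\<bar> \<le> 1 * \<bar>max \<bar>a i\<bar> \<bar>b i\<bar>\<bar>) U" by (simp add: abs_if max_def)
    show "eventually (\<lambda>i. \<bar>max \<bar>a i\<bar> \<bar>b i\<bar>\<bar> \<le> max 1 C * \<bar>b i\<bar>) U"
      using C
    proof eventually_elim
      case (elim i)
      have "1 * \<bar>b i\<bar> \<le> max 1 C * \<bar>b i\<bar>" "C * \<bar>b i\<bar> \<le> max 1 C * \<bar>b i\<bar>"
        by (intro mult_right_mono; simp)+
      with elim have "\<bar>a i\<bar> \<le> max 1 C * \<bar>b i\<bar>" "\<bar>b i\<bar> \<le> max 1 C * \<bar>b i\<bar>" by linarith+
      then show ?case by (auto simp: max_def[of "\<bar>a i\<bar>"])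
    qed
  qed
  with True show ?thesis by (simp add: growth_max_def growth_of_eq_iff)
next
  case False
  then have "eventually (\<lambda>i. \<bar>b i\<bar> < \<bar>a i\<bar>) U" by (rule not_growth_le_class)
  then have "eventually (\<lambda>i. \<bar>a i\<bar> = max \<bar>a i\<bar> \<bar>b i\<bar>) U" by eventually_elim simp
  then have "comparable a (\<lambda>i. max \<bar>a i\<bar> \<bar>b i\<bar>)"
    by (intro comparableI[of _ 1 _ 1]; eventually_elim) simp_all
  with False show ?thesis by (simp add: growth_max_def growth_of_eq_iff)
qed

section \<open>Membership conditions as estimates on representatives\<close>

lemma HInt_fine_growth_class:
  "cls f \<in> HInt_fine_growth U (growth_of U (cls a)) (growth_of U (cls c)) \<longleftrightarrow>
    cls f \<in> HInt U \<and> (\<forall>C>0. eventually (\<lambda>i. C * (\<bar>f i\<bar> * \<bar>a i\<bar>) < \<bar>c i\<bar>) U)"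
  by (simp add: HInt_fine_growth_def growth_dilate_def growth_mul_class growth_less_class abs_mult)

text \<open>Clearing the inverse turns this into the fine condition with 1 in place of the bracket
  representative, so that \<open>growth_add\<close> can treat both kinds of growth.\<close>

lemma HInt_growth_class:
  "cls f \<in> HInt_growth U (growth_of U (cls a)) \<longleftrightarrow>
    cls f \<in> HInt U \<and> (\<forall>C>0. eventually (\<lambda>i. C * (\<bar>f i\<bar> * \<bar>a i\<bar>) < 1) U)"
proof (cases "eventually (\<lambda>i. f i = 0) U")
  case True
  \<comment> \<open>Zero is a separate clause of the definition, since \<open>inverse 0 = 0\<close>
    does not stand for infinite growth; the product form holds for it trivially.\<close>
  then have "eventually (\<lambda>i. C * (\<bar>f i\<bar> * \<bar>a i\<bar>) < 1) U" for C by eventually_elim simp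
  with True show ?thesis by (simp add: HInt_growth_def hreal_of_class ultra_class_eq_iff)
next
  case False
  then have nz: "eventually (\<lambda>i. f i \<noteq> 0) U" by (simp add: not_eventually_iff)
  have "eventually (\<lambda>i. C * \<bar>a i\<bar> < \<bar>inverse (f i)\<bar>) U \<longleftrightarrow>
      eventually (\<lambda>i. C * (\<bar>f i\<bar> * \<bar>a i\<bar>) < 1) U" for C
  proof (rule eventually_cong[OF nz])
    fix i assume "f i \<noteq> 0"
    then show "C * \<bar>a i\<bar> < \<bar>inverse (f i)\<bar> \<longleftrightarrow> C * (\<bar>f i\<bar> * \<bar>a i\<bar>) < 1"
      by (simp add: field_simps)
  qed
  with False show ?thesis
    by (simp add: HInt_growth_def hreal_of_class ultra_class_eq_iff growth_inv_class
        growth_less_class)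
qed

text \<open>Multiplying by the argument makes the decay condition a bound on the product of error
  and argument. This form also covers zero and is the one that can be expanded for a sum.\<close>

lemma HDioph_inv_class:
  assumes inf: "cls (\<lambda>i. f i * \<theta> - real_of_int (p i)) \<in> HInfinitesimal U" and int: "cls f \<in> HInt U"
  shows "cls f \<in> HDioph_inv U \<theta> \<longleftrightarrow>
    (\<exists>C>0. eventually (\<lambda>i. \<bar>f i * \<theta> - real_of_int (p i)\<bar> * \<bar>f i\<bar> \<le> C) U)"
proof (cases "eventually (\<lambda>i. f i = 0) U")
  case True
  then have "eventually (\<lambda>i. \<bar>f i * \<theta> - real_of_int (p i)\<bar> * \<bar>f i\<bar> \<le> 1) U"
    by eventually_elim simp
  moreover have "cls f \<in> HDioph_inv U \<theta>"
    using True by (simp add: HDioph_inv_def hreal_of_class ultra_class_eq_iff)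
  ultimately show ?thesis using zero_less_one by blast
next
  case False
  then have nz: "eventually (\<lambda>i. f i \<noteq> 0) U" by (simp add: not_eventually_iff)
  have "cls f \<in> HDioph U \<theta>"
    using int inf by (auto simp: HDioph_def HInt_eq hyper_class hreal_of_class)
  with False have iff: "cls f \<in> HDioph_inv U \<theta> \<longleftrightarrow>
      (\<exists>C>0. eventually (\<lambda>i. \<bar>f i * \<theta> - real_of_int (p i)\<bar> < C * inverse \<bar>f i\<bar>) U)"
    by (simp add: HDioph_inv_def herr_class[OF inf] hreal_of_class hyper_class hless_class
        ultra_class_eq_iff)
  show ?thesis
    unfolding iff
  proof (intro iffI; elim exE conjE)
    fix C :: real
    assume "C > 0" and e: "eventually (\<lambda>i. \<bar>f i * \<theta> - real_of_int (p i)\<bar> < C * inverse \<bar>f i\<bar>) U"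
    have "eventually (\<lambda>i. \<bar>f i * \<theta> - real_of_int (p i)\<bar> * \<bar>f i\<bar> \<le> C) U"
      using e nz by eventually_elim (simp add: field_simps)
    with \<open>C > 0\<close> show "\<exists>C>0. eventually (\<lambda>i. \<bar>f i * \<theta> - real_of_int (p i)\<bar> * \<bar>f i\<bar> \<le> C) U"
      by blast
  next
    fix C :: real
    assume "C > 0" and e: "eventually (\<lambda>i. \<bar>f i * \<theta> - real_of_int (p i)\<bar> * \<bar>f i\<bar> \<le> C) U"
    \<comment> \<open>\<open>C + 1\<close> restores the strict inequality after division by
      \<open>\<bar>f i\<bar>\<close>, which is positive almost everywhere.\<close>
    have "eventually (\<lambda>i. \<bar>f i * \<theta> - real_of_int (p i)\<bar> < (C + 1) * inverse \<bar>f i\<bar>) U"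
      using e nz
    proof eventually_elim
      case (elim i)
      have "\<bar>f i * \<theta> - real_of_int (p i)\<bar> \<le> C / \<bar>f i\<bar>"
        using elim by (simp add: pos_le_divide_eq)
      also have "\<dots> < (C + 1) / \<bar>f i\<bar>" using elim by (simp add: divide_strict_right_mono)
      finally show ?case by (simp add: divide_inverse)
    qed
    with \<open>C > 0\<close>
    show "\<exists>C>0. eventually (\<lambda>i. \<bar>f i * \<theta> - real_of_int (p i)\<bar> < C * inverse \<bar>f i\<bar>) U"
      by (intro exI[of _ "C + 1"]) simp
  qed
qed

lemma HDioph_decay_class:
  assumes inf: "cls (\<lambda>i. f i * \<theta> - real_of_int (p i)) \<in> HInfinitesimal U"
    and "cls f \<in> HDioph_decay U (growth_of U (cls b)) \<theta>"
  obtains C where "C > 0" "eventually (\<lambda>i. \<bar>f i * \<theta> - real_of_int (p i)\<bar> \<le> C * \<bar>b i\<bar>) U"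
  using assms by (auto simp: HDioph_decay_def herr_class[OF inf] growth_le_class)

section \<open>Sums: integrality, decay and growth\<close>

lemma HInt_add_class:
  assumes "cls f \<in> HInt U" "cls g \<in> HInt U"
  shows "cls (\<lambda>i. f i + g i) \<in> HInt U"
proof -
  obtain k l where "cls f = cls (\<lambda>i. real_of_int (k i))" "cls g = cls (\<lambda>i. real_of_int (l i))"
    using assms by (auto simp: HInt_eq)
  then have "eventually (\<lambda>i. f i = real_of_int (k i)) U" "eventually (\<lambda>i. g i = real_of_int (l i)) U"
    by (simp_all add: ultra_class_eq_iff)
  then have "eventually (\<lambda>i. f i + g i = real_of_int (k i + l i)) U" by eventually_elim simp
  then have "cls (\<lambda>i. f i + g i) = cls (\<lambda>i. real_of_int (k i + l i))"
    by (simp only: ultra_class_eq_iff)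
  then show ?thesis unfolding HInt_eq mem_Collect_eq by (intro exI[of _ "\<lambda>i. k i + l i"]) simp
qed

text \<open>The bounds \<open>fa\<close> and \<open>gb\<close> control the cross terms. Plain growth
  implies them, and so does fine growth with infinitesimal bracket index, so both inclusions can use
  this lemma.\<close>

lemma HDioph_inv_add:
  assumes f: "cls f \<in> HDioph_decay U (growth_of U (cls b)) \<theta>" "cls f \<in> HDioph_inv U \<theta>"
    and g: "cls g \<in> HDioph_decay U (growth_of U (cls a)) \<theta>" "cls g \<in> HDioph_inv U \<theta>"
    and fa: "eventually (\<lambda>i. \<bar>f i\<bar> * \<bar>a i\<bar> < 1) U" and gb: "eventually (\<lambda>i. \<bar>g i\<bar> * \<bar>b i\<bar> < 1) U"
  shows "cls (\<lambda>i. f i + g i) \<in> HDioph_inv U \<theta>"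
proof -
  have fD: "cls f \<in> HDioph U \<theta>" and gD: "cls g \<in> HDioph U \<theta>"
    using f(1) g(1) by (auto simp: HDioph_decay_def)
  then have fZ: "cls f \<in> HInt U" and gZ: "cls g \<in> HInt U" by (auto simp: HDioph_def)
  obtain p q where p: "cls (\<lambda>i. f i * \<theta> - real_of_int (p i)) \<in> HInfinitesimal U"
    and q: "cls (\<lambda>i. g i * \<theta> - real_of_int (q i)) \<in> HInfinitesimal U"
    using fD gD by (metis HDioph_class)
  \<comment> \<open>The errors add: \<open>p + q\<close> is an admissible integer part for the
    sum.\<close>
  have "cls (\<lambda>i. (f i + g i) * \<theta> - real_of_int (p i + q i)) \<in> HInfinitesimal U"
    using HInfinitesimal_add[OF p q] by (simp add: algebra_simps)
  note iff = HDioph_inv_class[OF this HInt_add_class[OF fZ gZ]]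
  obtain C where "C > 0" and C: "eventually (\<lambda>i. \<bar>f i * \<theta> - real_of_int (p i)\<bar> * \<bar>f i\<bar> \<le> C) U"
    using f(2) unfolding HDioph_inv_class[OF p fZ] by blast
  obtain D where "D > 0" and D: "eventually (\<lambda>i. \<bar>g i * \<theta> - real_of_int (q i)\<bar> * \<bar>g i\<bar> \<le> D) U"
    using g(2) unfolding HDioph_inv_class[OF q gZ] by blast
  obtain C' where "C' > 0" and C': "eventually (\<lambda>i. \<bar>f i * \<theta> - real_of_int (p i)\<bar> \<le> C' * \<bar>b i\<bar>) U"
    using HDioph_decay_class[OF p f(1)] .
  obtain D' where "D' > 0" and D': "eventually (\<lambda>i. \<bar>g i * \<theta> - real_of_int (q i)\<bar> \<le> D' * \<bar>a i\<bar>) U"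
    using HDioph_decay_class[OF q g(1)] .
  \<comment> \<open>\<open>C\<close> and \<open>D\<close> bound the diagonal terms,
    \<open>C'\<close> and \<open>D'\<close> the cross terms.\<close>
  have "eventually (\<lambda>i. \<bar>(f i + g i) * \<theta> - real_of_int (p i + q i)\<bar> * \<bar>f i + g i\<bar>
      \<le> C + D + C' + D') U"
    using C D C' D' fa gb
  proof eventually_elim
    case (elim i)
    define e e' where "e = f i * \<theta> - real_of_int (p i)" and "e' = g i * \<theta> - real_of_int (q i)"
    \<comment> \<open>Here the crossing of indices enters: \<open>b\<close> measures the decay of
      the error of \<open>f\<close> and the growth of \<open>g\<close>. The other cross term is
      symmetric.\<close>
    have "\<bar>e\<bar> * \<bar>g i\<bar> \<le> C' * \<bar>b i\<bar> * \<bar>g i\<bar>"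
      using elim by (intro mult_right_mono) (auto simp: e_def)
    also have "\<dots> = C' * (\<bar>g i\<bar> * \<bar>b i\<bar>)" by simp
    also have "\<dots> \<le> C' * 1" using elim \<open>C' > 0\<close> by (intro mult_left_mono) auto
    finally have 1: "\<bar>e\<bar> * \<bar>g i\<bar> \<le> C'" by simp
    have "\<bar>e'\<bar> * \<bar>f i\<bar> \<le> D' * \<bar>a i\<bar> * \<bar>f i\<bar>"
      using elim by (intro mult_right_mono) (auto simp: e'_def)
    also have "\<dots> = D' * (\<bar>f i\<bar> * \<bar>a i\<bar>)" by simp
    also have "\<dots> \<le> D' * 1" using elim \<open>D' > 0\<close> by (intro mult_left_mono) auto
    finally have 2: "\<bar>e'\<bar> * \<bar>f i\<bar> \<le> D'" by simp
    have "\<bar>e + e'\<bar> * \<bar>f i + g i\<bar> \<le> (\<bar>e\<bar> + \<bar>e'\<bar>) * (\<bar>f i\<bar> + \<bar>g i\<bar>)"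
      by (intro mult_mono) auto
    also have "\<dots> = \<bar>e\<bar> * \<bar>f i\<bar> + \<bar>e'\<bar> * \<bar>g i\<bar> + \<bar>e\<bar> * \<bar>g i\<bar> + \<bar>e'\<bar> * \<bar>f i\<bar>"
      by (simp add: algebra_simps)
    also have "\<dots> \<le> C + D + C' + D'"
      using elim 1 2 unfolding e_def e'_def by linarith
    finally show ?case by (simp add: e_def e'_def algebra_simps)
  qed
  moreover have "C + D + C' + D' > 0" using \<open>C > 0\<close> \<open>D > 0\<close> \<open>C' > 0\<close> \<open>D' > 0\<close> by simp
  ultimately show ?thesis unfolding iff by blast
qed

text \<open>The minimum is at most either index, so each summand is weighed against its own. The
  targets \<open>c\<close> and \<open>d\<close> stay arbitrary, to become bracket representatives or
  the constant 1.\<close>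

lemma growth_add:
  fixes f g a b c d :: "nat \<Rightarrow> real"
  assumes f: "\<forall>C>0. eventually (\<lambda>i. C * (\<bar>f i\<bar> * \<bar>a i\<bar>) < c i) U"
    and g: "\<forall>C>0. eventually (\<lambda>i. C * (\<bar>g i\<bar> * \<bar>b i\<bar>) < d i) U"
  shows "\<forall>C>0. eventually (\<lambda>i. C * (\<bar>f i + g i\<bar> * \<bar>min \<bar>a i\<bar> \<bar>b i\<bar>\<bar>) < max (c i) (d i)) U"
proof (intro allI impI)
  fix C :: real assume "C > 0"
  \<comment> \<open>With \<open>2 * C\<close> each term is below half its target, and half of
    \<open>c + d\<close> is at most the maximum.\<close>
  then have "eventually (\<lambda>i. 2 * C * (\<bar>f i\<bar> * \<bar>a i\<bar>) < c i) U"
    "eventually (\<lambda>i. 2 * C * (\<bar>g i\<bar> * \<bar>b i\<bar>) < d i) U"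
    using f g by simp_all
  then show "eventually (\<lambda>i. C * (\<bar>f i + g i\<bar> * \<bar>min \<bar>a i\<bar> \<bar>b i\<bar>\<bar>) < max (c i) (d i)) U"
  proof eventually_elim
    case (elim i)
    have "\<bar>f i + g i\<bar> * min \<bar>a i\<bar> \<bar>b i\<bar> \<le> (\<bar>f i\<bar> + \<bar>g i\<bar>) * min \<bar>a i\<bar> \<bar>b i\<bar>"
      by (intro mult_right_mono) auto
    also have "\<dots> = \<bar>f i\<bar> * min \<bar>a i\<bar> \<bar>b i\<bar> + \<bar>g i\<bar> * min \<bar>a i\<bar> \<bar>b i\<bar>"
      by (simp add: distrib_right)
    also have "\<dots> \<le> \<bar>f i\<bar> * \<bar>a i\<bar> + \<bar>g i\<bar> * \<bar>b i\<bar>"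
      by (intro add_mono mult_left_mono) auto
    finally have "C * (\<bar>f i + g i\<bar> * min \<bar>a i\<bar> \<bar>b i\<bar>) \<le> C * (\<bar>f i\<bar> * \<bar>a i\<bar> + \<bar>g i\<bar> * \<bar>b i\<bar>)"
      using \<open>C > 0\<close> by (intro mult_left_mono) auto
    also have "\<dots> = C * (\<bar>f i\<bar> * \<bar>a i\<bar>) + C * (\<bar>g i\<bar> * \<bar>b i\<bar>)"
      by (simp add: distrib_left)
    also have "\<dots> < max (c i) (d i)"
      using elim by linarith
    finally show ?case by simp
  qed
qed

lemma HDioph_inv_fine_growth_add:
  assumes c: "cls c \<in> HInfinitesimal U" and d: "cls d \<in> HInfinitesimal U"
    and f: "cls f \<in> HDioph_inv_fine_growth_decay U (growth_of U (cls a)) (growth_of U (cls c))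
      (growth_of U (cls b)) \<theta>"
    and g: "cls g \<in> HDioph_inv_fine_growth_decay U (growth_of U (cls b)) (growth_of U (cls d))
      (growth_of U (cls a)) \<theta>"
  shows "cls (\<lambda>i. f i + g i) \<in> HDioph_inv_fine_growth U
      (growth_min U (growth_of U (cls a)) (growth_of U (cls b)))
      (growth_max U (growth_of U (cls c)) (growth_of U (cls d))) \<theta>"
proof -
  from f g have fZ: "cls f \<in> HInt U" and gZ: "cls g \<in> HInt U"
    and fa: "\<forall>C>0. eventually (\<lambda>i. C * (\<bar>f i\<bar> * \<bar>a i\<bar>) < \<bar>c i\<bar>) U"
    and gb: "\<forall>C>0. eventually (\<lambda>i. C * (\<bar>g i\<bar> * \<bar>b i\<bar>) < \<bar>d i\<bar>) U"
    by (simp_all add: HDioph_inv_fine_growth_decay_def HInt_fine_growth_class)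
  \<comment> \<open>Infinitesimality of the bracket index enters here, through
    \<open>\<bar>f i\<bar> * \<bar>a i\<bar> < \<bar>c i\<bar> < 1\<close>.\<close>
  have "eventually (\<lambda>i. 1 * (\<bar>f i\<bar> * \<bar>a i\<bar>) < \<bar>c i\<bar>) U" "eventually (\<lambda>i. \<bar>c i\<bar> < 1) U"
    using fa c by (auto simp: HInfinitesimal_class simp del: mult_1)
  then have fa1: "eventually (\<lambda>i. \<bar>f i\<bar> * \<bar>a i\<bar> < 1) U" by eventually_elim simp
  have "eventually (\<lambda>i. 1 * (\<bar>g i\<bar> * \<bar>b i\<bar>) < \<bar>d i\<bar>) U" "eventually (\<lambda>i. \<bar>d i\<bar> < 1) U"
    using gb d by (auto simp: HInfinitesimal_class simp del: mult_1)
  then have gb1: "eventually (\<lambda>i. \<bar>g i\<bar> * \<bar>b i\<bar> < 1) U" by eventually_elim simp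
  \<comment> \<open>The fine condition puts an outer absolute value around the maximum, which
    \<open>growth_add\<close> does not have.\<close>
  have "\<bar>max \<bar>x\<bar> \<bar>y\<bar>\<bar> = max \<bar>x\<bar> \<bar>y\<bar>" for x y :: real by simp
  then have "cls (\<lambda>i. f i + g i) \<in> HInt_fine_growth U
      (growth_min U (growth_of U (cls a)) (growth_of U (cls b)))
      (growth_max U (growth_of U (cls c)) (growth_of U (cls d)))"
    using growth_add[OF fa gb] HInt_add_class[OF fZ gZ]
    by (simp only: growth_min_class growth_max_class HInt_fine_growth_class simp_thms)
  moreover have "cls (\<lambda>i. f i + g i) \<in> HDioph_inv U \<theta>"
    using f g fa1 gb1 unfolding HDioph_inv_fine_growth_decay_def
    by (intro HDioph_inv_add) auto
  ultimately show ?thesis by (simp add: HDioph_inv_fine_growth_def)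
qed

lemma HDioph_inv_growth_add:
  assumes f: "cls f \<in> HDioph_inv_growth_decay U (growth_of U (cls a)) (growth_of U (cls b)) \<theta>"
    and g: "cls g \<in> HDioph_inv_growth_decay U (growth_of U (cls b)) (growth_of U (cls a)) \<theta>"
  shows "cls (\<lambda>i. f i + g i) \<in> HDioph_inv_growth U
      (growth_min U (growth_of U (cls a)) (growth_of U (cls b))) \<theta>"
proof -
  from f g have fZ: "cls f \<in> HInt U" and gZ: "cls g \<in> HInt U"
    and fa: "\<forall>C>0. eventually (\<lambda>i. C * (\<bar>f i\<bar> * \<bar>a i\<bar>) < 1) U"
    and gb: "\<forall>C>0. eventually (\<lambda>i. C * (\<bar>g i\<bar> * \<bar>b i\<bar>) < 1) U"
    by (simp_all add: HDioph_inv_growth_decay_def HInt_growth_class)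
  \<comment> \<open>Both targets in \<open>growth_add\<close> are the constant 1, and
    \<open>max.idem\<close> merges them.\<close>
  have "cls (\<lambda>i. f i + g i) \<in> HInt_growth U
      (growth_min U (growth_of U (cls a)) (growth_of U (cls b)))"
    using growth_add[OF fa gb] HInt_add_class[OF fZ gZ]
    by (simp only: growth_min_class HInt_growth_class simp_thms max.idem)
  moreover have "cls (\<lambda>i. f i + g i) \<in> HDioph_inv U \<theta>"
  proof (rule HDioph_inv_add)
    show "eventually (\<lambda>i. \<bar>f i\<bar> * \<bar>a i\<bar> < 1) U" using fa[rule_format, of 1] by simp
    show "eventually (\<lambda>i. \<bar>g i\<bar> * \<bar>b i\<bar> < 1) U" using gb[rule_format, of 1] by simp
  qed (use f g in \<open>auto simp: HDioph_inv_growth_decay_def\<close>)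
  ultimately show ?thesis by (simp add: HDioph_inv_growth_def)
qed

end

section \<open>From representatives back to the sets in the ultrapower\<close>

lemma Growth_eps_class:
  assumes "\<mu> \<in> Growth_eps U"
  obtains a where "\<mu> = growth_of U (ultra_class U a)" "ultra_class U a \<in> HInfinitesimal U"
  using assms by (auto simp: Growth_eps_def HInfinitesimal_def elim: HReal_cases)

lemma HDioph_inv_cases:
  assumes "x \<in> HDioph_inv U \<theta>"
  obtains f where "x = ultra_class U f"
  using assms by (auto simp: HDioph_inv_def HDioph_def HInt_eq hreal_of_class)

theorem theorem16:
  fixes U :: "nat filter" and \<theta> :: real and \<mu> \<nu> \<iota> \<kappa> :: growth
  assumes "nonprincipal_ultrafilter U"
    and "\<mu> \<in> Growth_eps U" and "\<nu> \<in> Growth_eps U"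
    and "\<iota> \<in> Growth_eps U" and "\<kappa> \<in> Growth_eps U"
  shows "hset_add U (HDioph_inv_fine_growth_decay U \<mu> \<iota> \<nu> \<theta>)
                    (HDioph_inv_fine_growth_decay U \<nu> \<kappa> \<mu> \<theta>)
           \<subseteq> HDioph_inv_fine_growth U (growth_min U \<mu> \<nu>) (growth_max U \<iota> \<kappa>) \<theta>
       \<and> hset_add U (HDioph_inv_growth_decay U \<mu> \<nu> \<theta>)
                    (HDioph_inv_growth_decay U \<nu> \<mu> \<theta>)
           \<subseteq> HDioph_inv_growth U (growth_min U \<mu> \<nu>) \<theta>"
proof -
  interpret ultra U
    using assms(1) by unfold_locales (auto simp: nonprincipal_ultrafilter_def)
  obtain a where a: "\<mu> = growth_of U (cls a)" using assms(2) by (rule Growth_eps_class)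
  obtain b where b: "\<nu> = growth_of U (cls b)" using assms(3) by (rule Growth_eps_class)
  \<comment> \<open>For the bracket indices the infinitesimality of the representative is kept,
    since it bounds the cross terms.\<close>
  obtain c where c: "\<iota> = growth_of U (cls c)" "cls c \<in> HInfinitesimal U"
    using assms(4) by (rule Growth_eps_class)
  obtain d where d: "\<kappa> = growth_of U (cls d)" "cls d \<in> HInfinitesimal U"
    using assms(5) by (rule Growth_eps_class)
  have "hadd U x y \<in> HDioph_inv_fine_growth U (growth_min U \<mu> \<nu>) (growth_max U \<iota> \<kappa>) \<theta>"
    if x: "x \<in> HDioph_inv_fine_growth_decay U \<mu> \<iota> \<nu> \<theta>"
      and y: "y \<in> HDioph_inv_fine_growth_decay U \<nu> \<kappa> \<mu> \<theta>" for x y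
  proof -
    \<comment> \<open>Membership in \<open>HDioph_inv\<close> supplies representatives; its adjoined
      zero is the class of a constant sequence.\<close>
    obtain f g where fg: "x = cls f" "y = cls g"
      using x y unfolding HDioph_inv_fine_growth_decay_def by (metis HDioph_inv_cases IntD2)
    show ?thesis
      using HDioph_inv_fine_growth_add[OF c(2) d(2)] x y unfolding a b c(1) d(1) fg hyper_class
      by blast
  qed
  moreover have "hadd U x y \<in> HDioph_inv_growth U (growth_min U \<mu> \<nu>) \<theta>"
    if x: "x \<in> HDioph_inv_growth_decay U \<mu> \<nu> \<theta>"
      and y: "y \<in> HDioph_inv_growth_decay U \<nu> \<mu> \<theta>" for x y
  proof -
    obtain f g where fg: "x = cls f" "y = cls g"
      using x y unfolding HDioph_inv_growth_decay_def by (metis HDioph_inv_cases IntD2)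
    show ?thesis
      using HDioph_inv_growth_add x y unfolding a b fg hyper_class by blast
  qed
  ultimately show ?thesis by (auto simp: hset_add_def)
qed

end
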